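(* Let $\mathcal{H}$ be an infinite dimensional Hilbert space, and let $A\in\mathcal{B}(\mathcal{H})$ and $\mu\in\mathbb{C}$ be such that $A-\mu I$ is compact. Then the following are equivalent: (a) $\Lambda_\infty(A)$ is non-empty; (b) $\Lambda_\infty(A)=\{\mu\}$; (c) $\mu\in\Lambda_k(A)$ for each $k=1,2,\dots$.
   Context: $\mathcal{B}(\mathcal{H})$ is the algebra of bounded linear operators on the complex Hilbert space $\mathcal{H}$. For a positive integer $k$ or $k=\infty$, $\Lambda_k(A)=\{\lambda\in\mathbb{C}: PAP=\lambda P\text{ for some rank-}k\text{ orthogonal projection }P\in\mathcal{B}(\mathcal{H})\}$ (for $k=\infty$, $P$ has infinite rank). *)

theory Defs
  imports "HOL-Analysis.Analysis" "HOL-Library.Extended_Nat"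
begin

text \<open>
  The \<^class>\<open>real_inner\<close> structure is the one underlying the complex structure: real scalars act
  through the complex scalars and the real inner product is the real part of the complex one.
  Positive definiteness of \<open>cinner\<close> and
  \<open>norm x = sqrt (Re (cinner x x))\<close> are thereby inherited. The complex inner product is linear in its first argument.
\<close>

class complex_inner = real_inner +
  fixes scaleC :: "complex \<Rightarrow> 'a \<Rightarrow> 'a" (infixr "*\<^sub>C" 75)
    and cinner :: "'a \<Rightarrow> 'a \<Rightarrow> complex"
  assumes scaleC_add_right: "a *\<^sub>C (x + y) = a *\<^sub>C x + a *\<^sub>C y"
    and scaleC_add_left: "(a + b) *\<^sub>C x = a *\<^sub>C x + b *\<^sub>C x"
    and scaleC_scaleC: "a *\<^sub>C b *\<^sub>C x = (a * b) *\<^sub>C x"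
    and scaleC_one: "1 *\<^sub>C x = x"
    and scaleR_scaleC: "r *\<^sub>R x = complex_of_real r *\<^sub>C x"
    and cinner_commute: "cinner x y = cnj (cinner y x)"
    and cinner_add_left: "cinner (x + y) z = cinner x z + cinner y z"
    and cinner_scaleC_left: "cinner (a *\<^sub>C x) y = a * cinner x y"
    and inner_eq_Re_cinner: "inner x y = Re (cinner x y)"

class complex_hilbert_space = complex_inner + complete_space

global_interpretation complex_vector:
  vector_space "scaleC :: complex \<Rightarrow> 'a \<Rightarrow> 'a::complex_inner"
  defines cspan = complex_vector.span
    and cdim = complex_vector.dim
  by unfold_locales
    (simp_all add: scaleC_add_right scaleC_add_left scaleC_scaleC scaleC_one)

text \<open>
  \<open>cdim\<close> is a natural number and is \<open>0\<close> for infinite-dimensional spaces; \<open>ecdim\<close> is \<open>\<infinity>\<close> for these.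
\<close>

definition ecdim :: "'a::complex_inner set \<Rightarrow> enat" where
  "ecdim V = (if \<exists>B. finite B \<and> V \<subseteq> cspan B then enat (cdim V) else \<infinity>)"

definition bounded_clinear :: "('a::complex_inner \<Rightarrow> 'b::complex_inner) \<Rightarrow> bool" where
  "bounded_clinear T \<longleftrightarrow>
     Vector_Spaces.linear scaleC scaleC T \<and> (\<exists>K. \<forall>x. norm (T x) \<le> K * norm x)"

definition compact_operator :: "('a::complex_inner \<Rightarrow> 'b::complex_inner) \<Rightarrow> bool" where
  "compact_operator T \<longleftrightarrow> bounded_clinear T \<and> compact (closure (T ` cball 0 1))"

definition orthogonal_projection :: "('a::complex_inner \<Rightarrow> 'a) \<Rightarrow> bool" where
  "orthogonal_projection P \<longleftrightarrow>
     bounded_clinear P \<and> P \<circ> P = P \<and> (\<forall>x y. cinner (P x) y = cinner x (P y))"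

definition rank_numerical_range ::
    "enat \<Rightarrow> ('a::complex_inner \<Rightarrow> 'a) \<Rightarrow> complex set" where
  "rank_numerical_range k A =
     {c. \<exists>P. orthogonal_projection P \<and> ecdim (range P) = k \<and> (\<forall>x. P (A (P x)) = c *\<^sub>C P x)}"

end

theory Submission
  imports Defs
begin

text \<open>
  Membership of \<open>c\<close> in a rank-\<open>k\<close> numerical range of \<open>A\<close> says that the compression of \<open>A\<close> to some
  \<open>k\<close>-dimensional subspace is the scalar \<open>c\<close>, that is, \<open>cinner (A x) y = c * cinner x y\<close> on that
  subspace. Both directions of the translation between projections and orthonormal sequences with
  this property are used: a sequence \<open>e\<close> yields the projection \<open>x \<mapsto> \<Sum>i. cinner x (e i) *\<^sub>C e i\<close>
  (\<open>orthonormal_imp_rank_numerical_range\<close>), and an infinite-dimensional range yields a sequence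
  (\<open>rank_numerical_range_infinity_imp_orthonormal\<close>).

  Three facts make up the theorem. First, if \<open>A - \<mu>\<close> is compact, only \<open>\<mu>\<close> can lie in the
  infinite-rank range: orthonormal sequences tend weakly to \<open>0\<close>, compact operators turn this into
  norm convergence along a subsequence, and so the constant numbers
  \<open>c - \<mu> = cinner ((A - \<mu>) (e n)) (e n)\<close> tend to \<open>0\<close>
  (\<open>rank_numerical_range_infinity_compact_perturbation\<close>). Second, truncating an infinite
  orthonormal sequence gives every finite rank (\<open>rank_numerical_range_infinity_subset\<close>).

  Third, and this is the main point, a \<open>c\<close> that occurs for every finite rank occurs for infinite
  rank (\<open>rank_numerical_ranges_imp_infinity\<close>). The subspaces for the various ranks are unrelated,
  so they cannot be glued; instead, a sequence is built greedily. Given the vectors \<open>v\<close> found so far,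
  \<open>n\<close> in number, a new unit vector \<open>x\<close> has to satisfy the \<open>3 * n\<close> linear equations
  \<open>cinner x v = 0\<close>, \<open>cinner x (A v) = 0\<close>, \<open>cinner (A x) v = 0\<close> and the quadratic equation
  \<open>cinner (A x) x = c\<close>. The quadratic equation holds for all unit vectors of a subspace of dimension
  \<open>3 * n + 1\<close> that comes from the hypothesis for that rank, and such a subspace contains a solution of
  the linear equations.
\<close>

section \<open>Complex inner products\<close>

instance complex_hilbert_space \<subseteq> banach ..

lemma cinner_add_right: "cinner x (y + z) = cinner x y + cinner x z"
  by (metis cinner_add_left cinner_commute complex_cnj_add)

lemma cinner_scaleC_right: "cinner x (a *\<^sub>C y) = cnj a * cinner x y"
  by (metis cinner_scaleC_left cinner_commute complex_cnj_mult)

lemma cinner_self: "cinner x x = complex_of_real ((norm x)\<^sup>2)"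
proof -
  have "Im (cinner x x) = 0"
    by (metis cinner_commute Reals_cnj_iff complex_is_Real_iff)
  then show ?thesis
    by (simp add: complex_eq_iff power2_norm_eq_inner inner_eq_Re_cinner)
qed

lemma norm_scaleC: "norm (a *\<^sub>C x) = cmod a * norm (x :: 'a::complex_inner)"
proof -
  have "complex_of_real ((norm (a *\<^sub>C x))\<^sup>2) = (a * cnj a) * complex_of_real ((norm x)\<^sup>2)"
    unfolding cinner_self[symmetric] by (simp add: cinner_scaleC_left cinner_scaleC_right)
  also have "\<dots> = complex_of_real ((cmod a * norm x)\<^sup>2)"
    by (simp add: complex_norm_square[symmetric] power_mult_distrib)
  finally have "complex_of_real ((norm (a *\<^sub>C x))\<^sup>2) = complex_of_real ((cmod a * norm x)\<^sup>2)" .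
  then have "(norm (a *\<^sub>C x))\<^sup>2 = (cmod a * norm x)\<^sup>2"
    using of_real_eq_iff by blast
  then show ?thesis
    by (simp add: power2_eq_iff_nonneg)
qed

text \<open>
  Rotating \<open>x\<close> by a unimodular scalar makes \<open>cinner x y\<close> a nonnegative real number, so the
  complex inequality reduces to the real one.
\<close>

lemma norm_cinner_le: "cmod (cinner x y) \<le> norm x * norm y"
proof -
  obtain a where a: "cmod a = 1" "a * cinner x y = complex_of_real (cmod (cinner x y))"
  proof (cases "cinner x y = 0")
    case True
    then show ?thesis using that[of 1] by simp
  next
    case False
    have "cnj (sgn (cinner x y)) * cinner x y = complex_of_real (cmod (cinner x y))"
      using False complex_norm_square[of "cinner x y"]
      by (simp add: sgn_eq field_simps power2_eq_square)
    then show ?thesis using that[of "cnj (sgn (cinner x y))"] False by (simp add: norm_sgn)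
  qed
  have "cmod (cinner x y) = inner (a *\<^sub>C x) y"
    by (simp add: inner_eq_Re_cinner cinner_scaleC_left a)
  also have "\<dots> \<le> norm (a *\<^sub>C x) * norm y"
    by (rule norm_cauchy_schwarz)
  finally show ?thesis by (simp add: norm_scaleC a)
qed

lemma bounded_linear_cinner_left: "bounded_linear (\<lambda>x. cinner x y)"
  by (rule bounded_linear_intro[where K = "norm y"])
     (simp_all add: cinner_add_left scaleR_scaleC cinner_scaleC_left norm_cinner_le scaleR_conv_of_real)

lemma bounded_linear_cinner_right: "bounded_linear (\<lambda>y. cinner x y)"
  by (rule bounded_linear_intro[where K = "norm x"])
     (simp_all add: cinner_add_right scaleR_scaleC cinner_scaleC_right norm_cinner_le
        scaleR_conv_of_real mult.commute[of _ "norm x"])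

lemmas cinner_sum_left = linear_sum[OF bounded_linear.linear[OF bounded_linear_cinner_left]]
  and cinner_sum_right = linear_sum[OF bounded_linear.linear[OF bounded_linear_cinner_right]]
  and cinner_diff_left = linear_diff[OF bounded_linear.linear[OF bounded_linear_cinner_left]]
  and cinner_zero_left = linear_0[OF bounded_linear.linear[OF bounded_linear_cinner_left]]
  and cinner_zero_right = linear_0[OF bounded_linear.linear[OF bounded_linear_cinner_right]]

lemma bounded_linear_scaleC_right: "bounded_linear (\<lambda>x :: 'a::complex_inner. a *\<^sub>C x)"
  by (rule bounded_linear_intro[where K = "cmod a"])
     (simp_all add: scaleC_add_right scaleR_scaleC scaleC_scaleC norm_scaleC mult.commute)

lemma bounded_clinear_add: "bounded_clinear T \<Longrightarrow> T (x + y) = T x + T y"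
  and bounded_clinear_scaleC: "bounded_clinear T \<Longrightarrow> T (a *\<^sub>C x) = a *\<^sub>C T x"
  using module_hom.add[of scaleC scaleC T x y] module_hom.scale[of scaleC scaleC T a x]
  by (auto simp: bounded_clinear_def module_hom_iff_linear)

lemma bounded_clinear_imp_bounded_linear:
  assumes "bounded_clinear T"
  shows "bounded_linear T"
proof -
  obtain K where K: "\<And>x. norm (T x) \<le> K * norm x"
    using assms by (auto simp: bounded_clinear_def)
  show ?thesis
    by (rule bounded_linear_intro[where K = K])
       (simp_all add: bounded_clinear_add[OF assms] bounded_clinear_scaleC[OF assms]
          scaleR_scaleC K mult.commute)
qed

lemma bounded_clinearI:
  assumes "\<And>x y. T (x + y) = T x + T y" "\<And>a x. T (a *\<^sub>C x) = a *\<^sub>C T x"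
    and "\<And>x. norm (T x) \<le> K * norm x"
  shows "bounded_clinear T"
  unfolding bounded_clinear_def
proof (intro conjI exI allI)
  show "Vector_Spaces.linear (*\<^sub>C) (*\<^sub>C) T"
    by unfold_locales (simp_all add: assms(1,2) scaleC_add_right scaleC_add_left scaleC_scaleC scaleC_one)
qed (rule assms(3))

section \<open>Vectors annihilated by finitely many functionals\<close>

text \<open>Elimination of one unknown: the equation \<open>j\<close> is solved for the unknown \<open>p\<close>.\<close>

lemma underdetermined_system_has_nontrivial_solution:
  fixes a :: "'i \<Rightarrow> 'j \<Rightarrow> 'k::field"
  assumes "finite J" "finite I" "card J < card I"
  shows "\<exists>c. (\<exists>i\<in>I. c i \<noteq> 0) \<and> (\<forall>j\<in>J. (\<Sum>i\<in>I. c i * a i j) = 0)"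
  using assms
proof (induction J arbitrary: I a rule: finite_induct)
  case empty
  then obtain i where "i \<in> I" by fastforce
  then show ?case by (intro exI[of _ "\<lambda>_. 1"]) auto
next
  case (insert j J)
  show ?case
  proof (cases "\<forall>i\<in>I. a i j = 0")
    case True
    obtain c where "\<exists>i\<in>I. c i \<noteq> 0" "\<forall>j\<in>J. (\<Sum>i\<in>I. c i * a i j) = 0"
      using insert.IH[of I a] insert.prems insert.hyps by auto
    then show ?thesis using True by (intro exI[of _ c]) auto
  next
    case False
    then obtain p where p: "p \<in> I" "a p j \<noteq> 0" by blast
    define I' where "I' = I - {p}"
    have I': "finite I'" "p \<notin> I'" "I = insert p I'" "card J < card I'"
      using insert.prems insert.hyps p by (auto simp: I'_def)
    obtain c where c: "\<exists>i\<in>I'. c i \<noteq> 0"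
        "\<forall>l\<in>J. (\<Sum>i\<in>I'. c i * (a i l - a i j / a p j * a p l)) = 0"
      using insert.IH[of I' "\<lambda>i l. a i l - a i j / a p j * a p l"] I' by auto
    define d where "d = c(p := - (\<Sum>i\<in>I'. c i * a i j) / a p j)"
    have "(\<Sum>i\<in>I. d i * a i l) = (\<Sum>i\<in>I'. c i * (a i l - a i j / a p j * a p l))" for l
    proof -
      have "(\<Sum>i\<in>I. d i * a i l) = d p * a p l + (\<Sum>i\<in>I'. c i * a i l)"
        using I' by (auto simp: d_def intro!: sum.cong)
      then show ?thesis
        by (simp add: d_def algebra_simps sum_subtractf sum_divide_distrib sum_distrib_left)
    qed
    then have "\<forall>l\<in>insert j J. (\<Sum>i\<in>I. d i * a i l) = 0"
      using c(2) p(2) by auto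
    moreover have "\<exists>i\<in>I. d i \<noteq> 0"
      using c(1) I' by (auto simp: d_def)
    ultimately show ?thesis by blast
  qed
qed

text \<open>
  Fewer functionals than dimensions cannot separate points: the coordinates of \<open>x\<close> with respect to
  \<open>B\<close> are the unknowns of a homogeneous system with one equation for each functional.
\<close>

lemma unit_vector_in_common_kernel:
  fixes B :: "'a::complex_inner set" and F :: "('a \<Rightarrow> complex) set"
  assumes "complex_vector.independent B" "finite B" "finite F" "card F < card B"
    and lin: "\<And>f. f \<in> F \<Longrightarrow> Vector_Spaces.linear scaleC (*) f"
  shows "\<exists>x\<in>cspan B. norm x = 1 \<and> (\<forall>f\<in>F. f x = 0)"
proof -
  obtain c where c: "\<exists>b\<in>B. c b \<noteq> 0" "\<And>f. f \<in> F \<Longrightarrow> (\<Sum>b\<in>B. c b * f b) = 0"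
    using underdetermined_system_has_nontrivial_solution[OF assms(3,2,4), of "\<lambda>b f. f b"] by blast
  define x where "x = (\<Sum>b\<in>B. c b *\<^sub>C b)"
  have "x \<noteq> 0"
    using c(1) assms(1,2) unfolding x_def by (auto simp: complex_vector.independent_explicit_finite_subsets)
  have xB: "x \<in> cspan B"
    unfolding x_def by (intro complex_vector.span_sum complex_vector.span_scale complex_vector.span_base)
  have kernel: "f (a *\<^sub>C x) = 0" if "f \<in> F" for f a
  proof -
    interpret f: Vector_Spaces.linear scaleC "(*)" f by (rule lin[OF that])
    show ?thesis using c(2)[OF that] by (simp add: x_def f.scale f.sum)
  qed
  let ?y = "complex_of_real (inverse (norm x)) *\<^sub>C x"
  have "norm ?y = 1"
    using \<open>x \<noteq> 0\<close> by (simp add: norm_scaleC norm_inverse)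
  then show ?thesis
    using kernel xB complex_vector.span_scale by blast
qed

lemma infinite_ecdim_imp_independent_subset:
  assumes "ecdim V = \<infinity>"
  shows "\<exists>B\<subseteq>V. complex_vector.independent B \<and> finite B \<and> card B = n"
proof -
  obtain B where B: "B \<subseteq> V" "complex_vector.independent B" "V \<subseteq> cspan B"
    using complex_vector.maximal_independent_subset by blast
  then have "infinite B"
    using assms by (auto simp: ecdim_def split: if_splits)
  then obtain C where "C \<subseteq> B" "finite C" "card C = n"
    using infinite_arbitrarily_large by blast
  then show ?thesis
    using B complex_vector.independent_mono by blast
qed

lemma finite_ecdim_imp_independent_subset:
  assumes "ecdim V = enat n"
  shows "\<exists>B\<subseteq>V. complex_vector.independent B \<and> finite B \<and> card B = n"
proof -
  obtain C where C: "finite C" "V \<subseteq> cspan C" and n: "cdim V = n"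
    using assms by (auto simp: ecdim_def split: if_splits)
  obtain B where B: "B \<subseteq> V" "complex_vector.independent B" "V \<subseteq> cspan B" "card B = cdim V"
    using complex_vector.basis_exists by blast
  have "finite B"
    using complex_vector.independent_span_bound[OF C(1) B(2)] B(1) C(2) by blast
  then show ?thesis using B n by blast
qed

section \<open>Orthogonal projections from orthonormal sequences\<close>

text \<open>
  The vectors from index \<open>k\<close> on are forced to be \<open>0\<close>, so that finite and infinite orthonormal
  families are both sequences and give projections by one and the same series.
\<close>

definition orthonormal_upto :: "enat \<Rightarrow> (nat \<Rightarrow> 'a::complex_inner) \<Rightarrow> bool" where
  "orthonormal_upto k e \<longleftrightarrow>
     (\<forall>i j. cinner (e i) (e j) = (if i = j \<and> enat i < k then 1 else 0))"

context
  fixes k :: enat and e :: "nat \<Rightarrow> 'a::complex_inner"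
  assumes e: "orthonormal_upto k e"
begin

lemma cinner_orthonormal: "cinner (e i) (e j) = (if i = j \<and> enat i < k then 1 else 0)"
  using e by (simp add: orthonormal_upto_def)

lemma norm_orthonormal: "enat i < k \<Longrightarrow> norm (e i) = 1"
  using cinner_self[of "e i"] power2_eq_iff_nonneg[of "norm (e i)" 1]
  by (simp add: cinner_orthonormal flip: of_real_power)

lemma orthonormal_eq_zero: "\<not> enat i < k \<Longrightarrow> e i = 0"
  using cinner_self[of "e i"] by (simp add: cinner_orthonormal flip: of_real_power)

lemma cinner_orthonormal_sum:
  assumes "finite I" "j \<in> I"
  shows "cinner (\<Sum>i\<in>I. c i *\<^sub>C e i) (e j) = (if enat j < k then c j else 0)"
proof -
  have "cinner (\<Sum>i\<in>I. c i *\<^sub>C e i) (e j) = (\<Sum>i\<in>I. if i = j then (if enat j < k then c j else 0) else 0)"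
    unfolding cinner_sum_left
    by (rule sum.cong) (auto simp: cinner_scaleC_left cinner_orthonormal)
  then show ?thesis using assms by simp
qed

lemma norm_orthonormal_sum:
  assumes "finite I"
  shows "(norm (\<Sum>i\<in>I. c i *\<^sub>C e i))\<^sup>2 = (\<Sum>i\<in>I. if enat i < k then (cmod (c i))\<^sup>2 else 0)"
proof -
  let ?s = "\<Sum>i\<in>I. c i *\<^sub>C e i"
  have "cinner ?s ?s = (\<Sum>i\<in>I. cnj (c i) * cinner ?s (e i))"
    by (subst cinner_sum_right) (simp add: cinner_scaleC_right)
  also have "\<dots> = (\<Sum>i\<in>I. complex_of_real (if enat i < k then (cmod (c i))\<^sup>2 else 0))"
    by (rule sum.cong) (simp_all add: cinner_orthonormal_sum[OF assms] complex_norm_square mult.commute del: of_real_power)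
  finally show ?thesis
    unfolding cinner_self of_real_sum[symmetric] of_real_eq_iff .
qed

lemma Bessel_inequality: "(\<Sum>i<n. (cmod (cinner x (e i)))\<^sup>2) \<le> (norm x)\<^sup>2"
proof -
  let ?c = "\<lambda>i. cinner x (e i)"
  let ?s = "\<Sum>i<n. ?c i *\<^sub>C e i"
  have c0: "?c i = 0" if "\<not> enat i < k" for i
    by (simp add: orthonormal_eq_zero[OF that] cinner_zero_right)
  have S: "(norm ?s)\<^sup>2 = (\<Sum>i<n. (cmod (?c i))\<^sup>2)"
    by (subst norm_orthonormal_sum) (auto intro!: sum.cong simp: c0)
  have "cinner x ?s = (\<Sum>i<n. complex_of_real ((cmod (?c i))\<^sup>2))"
    by (simp add: cinner_sum_right cinner_scaleC_right complex_norm_square mult.commute del: of_real_power)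
  then have "inner x ?s = (\<Sum>i<n. (cmod (?c i))\<^sup>2)"
    by (simp add: inner_eq_Re_cinner del: of_real_power)
  moreover have "0 \<le> (norm (x - ?s))\<^sup>2" by simp
  moreover have "(norm (x - ?s))\<^sup>2 = (norm x)\<^sup>2 - 2 * inner x ?s + (norm ?s)\<^sup>2"
    by (simp add: power2_norm_eq_inner inner_diff_left inner_diff_right inner_commute)
  ultimately show ?thesis using S by simp
qed

lemma summable_Fourier_coefficients: "summable (\<lambda>i. (cmod (cinner x (e i)))\<^sup>2)"
  by (rule bounded_imp_summable[where B = "(norm x)\<^sup>2"])
     (use Bessel_inequality[of x "Suc _"] in \<open>simp_all add: lessThan_Suc_atMost\<close>)

lemma Fourier_coefficients_tendsto_zero: "(\<lambda>i. cinner x (e i)) \<longlonglongrightarrow> 0"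
proof -
  have "(\<lambda>i. sqrt ((cmod (cinner x (e i)))\<^sup>2)) \<longlonglongrightarrow> sqrt 0"
    by (intro tendsto_real_sqrt summable_LIMSEQ_zero summable_Fourier_coefficients)
  then show ?thesis by (simp add: tendsto_norm_zero_iff)
qed

lemma independent_orthonormal: "complex_vector.independent (e ` {i. enat i < k})"
  and inj_on_orthonormal: "inj_on e {i. enat i < k}"
proof -
  show inj: "inj_on e {i. enat i < k}"
    by (rule inj_onI) (metis cinner_orthonormal mem_Collect_eq zero_neq_one)
  show "complex_vector.independent (e ` {i. enat i < k})"
    unfolding complex_vector.independent_explicit_finite_subsets
  proof (intro allI impI ballI)
    fix C u v
    assume C: "C \<subseteq> e ` {i. enat i < k}" "finite C" "(\<Sum>v\<in>C. u v *\<^sub>C v) = 0" and v: "v \<in> C"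
    obtain I where I: "I \<subseteq> {i. enat i < k}" "finite I" "C = e ` I"
      using finite_subset_image[OF C(2,1)] by blast
    then have sum: "(\<Sum>i\<in>I. u (e i) *\<^sub>C e i) = 0"
      using C(3) inj by (simp add: sum.reindex[OF inj_on_subset[OF inj I(1)]])
    obtain j where j: "j \<in> I" "v = e j" using v I by blast
    then show "u v = 0"
      using cinner_orthonormal_sum[OF I(2) j(1), of "\<lambda>i. u (e i)"] I(1) sum
      by (auto simp: cinner_zero_left)
  qed
qed

end

definition orthonormal_projection :: "(nat \<Rightarrow> 'a::complex_hilbert_space) \<Rightarrow> 'a \<Rightarrow> 'a" where
  "orthonormal_projection e x = (\<Sum>i. cinner x (e i) *\<^sub>C e i)"

context
  fixes k :: enat and e :: "nat \<Rightarrow> 'a::complex_hilbert_space"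
  assumes e: "orthonormal_upto k e"
begin

text \<open>
  By the theorem of Pythagoras, the partial sums are Cauchy because the squared moduli of the
  coefficients are summable; completeness of the space enters here.
\<close>

lemma summable_Fourier_series: "summable (\<lambda>i. cinner x (e i) *\<^sub>C e i)"
  unfolding summable_Cauchy
proof (intro allI impI)
  fix \<epsilon> :: real assume "0 < \<epsilon>"
  then obtain N where N: "\<And>m n. N \<le> m \<Longrightarrow> norm (\<Sum>i=m..<n. (cmod (cinner x (e i)))\<^sup>2) < \<epsilon>\<^sup>2"
    using summable_Fourier_coefficients[OF e, of x] unfolding summable_Cauchy
    using \<open>0 < \<epsilon>\<close> zero_less_power[of \<epsilon> 2] by meson
  have "norm (\<Sum>i=m..<n. cinner x (e i) *\<^sub>C e i) < \<epsilon>" if "N \<le> m" for m n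
  proof -
    have "(norm (\<Sum>i=m..<n. cinner x (e i) *\<^sub>C e i))\<^sup>2 \<le> (\<Sum>i=m..<n. (cmod (cinner x (e i)))\<^sup>2)"
      by (subst norm_orthonormal_sum[OF e]) (auto intro!: sum_mono)
    also have "\<dots> < \<epsilon>\<^sup>2"
      using N[OF that, of n] by (simp add: abs_of_nonneg sum_nonneg)
    finally show ?thesis
      by (rule power_less_imp_less_base) (use \<open>0 < \<epsilon>\<close> in simp)
  qed
  then show "\<exists>N. \<forall>m\<ge>N. \<forall>n. norm (\<Sum>i=m..<n. cinner x (e i) *\<^sub>C e i) < \<epsilon>" by blast
qed

lemma bounded_linear_image_orthonormal_projection:
  assumes "bounded_linear T"
  shows "T (orthonormal_projection e x) = (\<Sum>i. T (cinner x (e i) *\<^sub>C e i))"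
  unfolding orthonormal_projection_def
  by (rule bounded_linear.suminf[OF assms summable_Fourier_series])

lemma orthonormal_projection_fixes: "orthonormal_projection e (e j) = e j"
proof -
  have "(\<lambda>i. cinner (e j) (e i) *\<^sub>C e i) = (\<lambda>i. if i = j then e j else 0)"
    using orthonormal_eq_zero[OF e]
    by (auto simp: fun_eq_iff cinner_orthonormal[OF e] scaleC_one)
  then show ?thesis
    unfolding orthonormal_projection_def using sums_unique[OF sums_single[of j "\<lambda>_. e j"]] by simp
qed

lemma bounded_clinear_orthonormal_projection: "bounded_clinear (orthonormal_projection e)"
proof (rule bounded_clinearI[where K = 1])
  fix x y :: 'a and a :: complex
  show "orthonormal_projection e (x + y) = orthonormal_projection e x + orthonormal_projection e y"
    by (simp add: orthonormal_projection_def suminf_add[OF summable_Fourier_series summable_Fourier_series]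
        cinner_add_left scaleC_add_left)
  show "orthonormal_projection e (a *\<^sub>C x) = a *\<^sub>C orthonormal_projection e x"
    by (subst bounded_linear_image_orthonormal_projection[OF bounded_linear_scaleC_right])
       (simp add: orthonormal_projection_def cinner_scaleC_left scaleC_scaleC)
  have "(\<lambda>n. norm (\<Sum>i<n. cinner x (e i) *\<^sub>C e i)) \<longlonglongrightarrow> norm (orthonormal_projection e x)"
    unfolding orthonormal_projection_def by (intro tendsto_norm summable_LIMSEQ summable_Fourier_series)
  moreover have "norm (\<Sum>i<n. cinner x (e i) *\<^sub>C e i) \<le> norm x" for n
  proof -
    have "(norm (\<Sum>i<n. cinner x (e i) *\<^sub>C e i))\<^sup>2 \<le> (\<Sum>i<n. (cmod (cinner x (e i)))\<^sup>2)"
      by (subst norm_orthonormal_sum[OF e]) (auto intro!: sum_mono)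
    also have "\<dots> \<le> (norm x)\<^sup>2" by (rule Bessel_inequality[OF e])
    finally show ?thesis by (simp add: power2_le_iff_abs_le)
  qed
  ultimately have "norm (orthonormal_projection e x) \<le> norm x"
    by - (rule LIMSEQ_le_const2, blast+)
  then show "norm (orthonormal_projection e x) \<le> 1 * norm x" by simp
qed

lemma orthogonal_projection_orthonormal_projection:
  "orthogonal_projection (orthonormal_projection e)"
  unfolding orthogonal_projection_def
proof (intro conjI allI ext)
  note P = bounded_clinear_orthonormal_projection
  show "bounded_clinear (orthonormal_projection e)" by (rule P)
  fix x y
  show "(orthonormal_projection e \<circ> orthonormal_projection e) x = orthonormal_projection e x"
    unfolding o_apply
      bounded_linear_image_orthonormal_projection[OF bounded_clinear_imp_bounded_linear[OF P]]
      bounded_clinear_scaleC[OF P] orthonormal_projection_fixes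
    by (simp add: orthonormal_projection_def)
  have "cinner (cinner x (e i) *\<^sub>C e i) y = cinner x (cinner y (e i) *\<^sub>C e i)" for i
    by (simp add: cinner_scaleC_left cinner_scaleC_right cinner_commute[of "e i" y])
  then show "cinner (orthonormal_projection e x) y = cinner x (orthonormal_projection e y)"
    using bounded_linear_image_orthonormal_projection[OF bounded_linear_cinner_left[of y], of x]
      bounded_linear_image_orthonormal_projection[OF bounded_linear_cinner_right[of x], of y] by simp
qed

lemma ecdim_range_orthonormal_projection: "ecdim (range (orthonormal_projection e)) = k"
proof (cases k)
  case (enat n)
  let ?R = "range (orthonormal_projection e)"
  let ?B = "e ` {i. enat i < k}"
  have I: "{i. enat i < k} = {..<n}" using enat by auto
  have "orthonormal_projection e x \<in> cspan ?B" for x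
  proof -
    have "orthonormal_projection e x = (\<Sum>i<n. cinner x (e i) *\<^sub>C e i)"
      unfolding orthonormal_projection_def
      by (rule suminf_finite) (auto simp: enat orthonormal_eq_zero[OF e])
    also have "\<dots> \<in> cspan ?B"
      by (intro complex_vector.span_sum complex_vector.span_scale complex_vector.span_base)
         (auto simp: I)
    finally show ?thesis .
  qed
  then have sub: "?R \<subseteq> cspan ?B" by blast
  have "?B \<subseteq> ?R" using orthonormal_projection_fixes by (metis image_subsetI rangeI)
  then have "cdim ?R = card ?B"
    using complex_vector.basis_card_eq_dim[OF _ sub independent_orthonormal[OF e]] by simp
  also have "\<dots> = n"
    using card_image[OF inj_on_orthonormal[OF e]] I by simp
  finally show ?thesis
    using sub enat I unfolding ecdim_def by (metis finite_imageI finite_lessThan)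
next
  case infinity
  let ?B = "e ` {i. enat i < k}"
  have "infinite ?B"
    using infinity finite_image_iff[OF inj_on_orthonormal[OF e]] by simp
  moreover have "finite ?B" if "finite C" "range (orthonormal_projection e) \<subseteq> cspan C" for C
  proof -
    have "?B \<subseteq> cspan C" using that(2) orthonormal_projection_fixes by (metis image_subset_iff range_eqI subsetD)
    then show ?thesis
      using complex_vector.independent_span_bound[OF that(1) independent_orthonormal[OF e]] by blast
  qed
  ultimately show ?thesis
    using infinity by (auto simp: ecdim_def)
qed

end

section \<open>Higher rank numerical ranges in terms of orthonormal sequences\<close>

lemma rank_numerical_range_cinner:
  assumes "orthogonal_projection P" "\<forall>x. P (A (P x)) = c *\<^sub>C P x"
    and "x \<in> range P" "y \<in> range P"
  shows "cinner (A x) y = c * cinner x y"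
proof -
  have fixed: "P x = x" "P y = y"
    using assms(1,3,4) by (auto simp: orthogonal_projection_def fun_eq_iff)
  then have "cinner (A x) y = cinner (P (A (P x))) y"
    using assms(1) by (metis orthogonal_projection_def)
  also have "P (A (P x)) = c *\<^sub>C x"
    using spec[OF assms(2), of x] by (simp add: fixed)
  finally show ?thesis by (simp add: cinner_scaleC_left)
qed

text \<open>
  Testing against the \<open>e j\<close> determines a projection, so \<open>P A P = c P\<close> is a statement about the
  matrix entries \<open>cinner (A (e i)) (e j)\<close>.
\<close>

lemma orthonormal_imp_rank_numerical_range:
  fixes e :: "nat \<Rightarrow> 'a::complex_hilbert_space"
  assumes A: "bounded_clinear A" and e: "orthonormal_upto k e"
    and Ae: "\<And>i j. cinner (A (e i)) (e j) = c * cinner (e i) (e j)"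
  shows "c \<in> rank_numerical_range k A"
proof -
  let ?P = "orthonormal_projection e"
  have "cinner (A (?P x)) (e j) = cinner (c *\<^sub>C ?P x) (e j)" for x j
  proof -
    have "bounded_linear (\<lambda>y. cinner (A y) (e j))" "bounded_linear (\<lambda>y. cinner (c *\<^sub>C y) (e j))"
      by (rule bounded_linear_compose[OF bounded_linear_cinner_left bounded_clinear_imp_bounded_linear[OF A]]
          bounded_linear_compose[OF bounded_linear_cinner_left bounded_linear_scaleC_right])+
    from this[THEN bounded_linear_image_orthonormal_projection[OF e]] show ?thesis
      by (simp add: bounded_clinear_scaleC[OF A] cinner_scaleC_left Ae mult.assoc mult.left_commute[of c])
  qed
  then have "?P (A (?P x)) = ?P (c *\<^sub>C ?P x)" for x
    by (simp add: orthonormal_projection_def[of e "A _"] orthonormal_projection_def[of e "c *\<^sub>C _"])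
  also have "?P (c *\<^sub>C ?P x) = c *\<^sub>C ?P x" for x
    using orthogonal_projection_orthonormal_projection[OF e]
    by (simp add: orthogonal_projection_def fun_eq_iff
        bounded_clinear_scaleC[OF bounded_clinear_orthonormal_projection[OF e]])
  finally show ?thesis
    unfolding rank_numerical_range_def
    using orthogonal_projection_orthonormal_projection[OF e] ecdim_range_orthonormal_projection[OF e]
    by blast
qed

text \<open>
  The choice of the next term may depend on the set of earlier terms, and needs to be possible for
  every finite set, not only for the sets that arise during the construction.
\<close>

lemma greedy_sequence:
  assumes "\<forall>S. finite S \<longrightarrow> (\<exists>x. Q S x)"
  shows "\<exists>e :: nat \<Rightarrow> 'b. \<forall>n. Q (e ` {..<n}) (e n)"
proof (rule dependent_wellorder_choice)
  fix f g :: "nat \<Rightarrow> 'b" and n r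
  assume "\<And>m. m < n \<Longrightarrow> f m = g m"
  then have "f ` {..<n} = g ` {..<n}" by auto
  then show "Q (f ` {..<n}) r = Q (g ` {..<n}) r" by simp
qed (simp add: assms)

lemma orthonormal_upto_infinityI:
  assumes "\<And>n. norm (e n) = 1" "\<And>m n. m < n \<Longrightarrow> cinner (e n) (e m) = 0"
  shows "orthonormal_upto \<infinity> e"
proof -
  have "cinner (e i) (e j) = 0" if "i \<noteq> j" for i j
    using that assms(2)[of i j] assms(2)[of j i] cinner_commute[of "e i" "e j"]
    by (cases i j rule: linorder_cases) auto
  then show ?thesis by (auto simp: orthonormal_upto_def cinner_self assms(1))
qed

lemma linear_cinner_left: "Vector_Spaces.linear scaleC (*) (\<lambda>x. cinner x v)"
  by unfold_locales
     (simp_all add: cinner_add_left cinner_scaleC_left algebra_simps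
        scaleC_add_right scaleC_add_left scaleC_scaleC scaleC_one)

lemma linear_cinner_bounded_clinear:
  assumes "bounded_clinear A"
  shows "Vector_Spaces.linear scaleC (*) (\<lambda>x. cinner (A x) v)"
  by unfold_locales
     (simp_all add: bounded_clinear_add[OF assms] bounded_clinear_scaleC[OF assms]
        cinner_add_left cinner_scaleC_left algebra_simps
        scaleC_add_right scaleC_add_left scaleC_scaleC scaleC_one)

lemma subspace_range_orthogonal_projection:
  assumes "orthogonal_projection P"
  shows "complex_vector.subspace (range P)"
  using assms module_hom.subspace_image[of scaleC scaleC P UNIV]
  by (auto simp: orthogonal_projection_def bounded_clinear_def module_hom_iff_linear)

lemma rank_numerical_range_infinity_imp_orthonormal:
  fixes A :: "'a::complex_inner \<Rightarrow> 'a"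
  assumes "c \<in> rank_numerical_range \<infinity> A"
  shows "\<exists>e. orthonormal_upto \<infinity> e \<and> (\<forall>i j. cinner (A (e i)) (e j) = c * cinner (e i) (e j))"
proof -
  obtain P where P: "orthogonal_projection P" "ecdim (range P) = \<infinity>" "\<forall>x. P (A (P x)) = c *\<^sub>C P x"
    using assms by (auto simp: rank_numerical_range_def)
  have step: "\<exists>x. x \<in> range P \<and> norm x = 1 \<and> (\<forall>v\<in>S. cinner x v = 0)" if "finite S" for S :: "'a set"
  proof -
    obtain B where B: "B \<subseteq> range P" "complex_vector.independent B" "finite B" "card B = Suc (card S)"
      using infinite_ecdim_imp_independent_subset[OF P(2)] by blast
    have "card ((\<lambda>v x. cinner x v) ` S) < card B"
      using card_image_le[OF that, of "\<lambda>v x. cinner x v"] B(4) by simp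
    then have "\<exists>x\<in>cspan B. norm x = 1 \<and> (\<forall>f\<in>(\<lambda>v x. cinner x v) ` S. f x = 0)"
      using that by (intro unit_vector_in_common_kernel[OF B(2,3)]) (auto intro: linear_cinner_left)
    then obtain x where "x \<in> cspan B" "norm x = 1" "\<forall>v\<in>S. cinner x v = 0"
      by auto
    moreover have "cspan B \<subseteq> range P"
      by (rule complex_vector.span_minimal[OF B(1) subspace_range_orthogonal_projection[OF P(1)]])
    ultimately show ?thesis by blast
  qed
  obtain e :: "nat \<Rightarrow> 'a" where e: "\<forall>n. e n \<in> range P \<and> norm (e n) = 1 \<and> (\<forall>v\<in>e ` {..<n}. cinner (e n) v = 0)"
    using greedy_sequence[of "\<lambda>S x. x \<in> range P \<and> norm x = 1 \<and> (\<forall>v\<in>S. cinner x v = 0)"] step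
    by blast
  then have "orthonormal_upto \<infinity> e"
    by (intro orthonormal_upto_infinityI) auto
  moreover have "cinner (A (e i)) (e j) = c * cinner (e i) (e j)" for i j
    by (intro rank_numerical_range_cinner[of P A c "e i" "e j"] P(1,3)) (simp_all add: e)
  ultimately show ?thesis by blast
qed

text \<open>Setting the terms from index \<open>k\<close> on to \<open>0\<close> keeps all matrix relations.\<close>

lemma rank_numerical_range_infinity_subset:
  fixes A :: "'a::complex_hilbert_space \<Rightarrow> 'a"
  assumes "bounded_clinear A" "c \<in> rank_numerical_range \<infinity> A"
  shows "c \<in> rank_numerical_range k A"
proof -
  obtain e where e: "orthonormal_upto \<infinity> e" "\<And>i j. cinner (A (e i)) (e j) = c * cinner (e i) (e j)"
    using rank_numerical_range_infinity_imp_orthonormal[OF assms(2)] by blast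
  let ?e = "\<lambda>i. if enat i < k then e i else 0"
  have A0: "A 0 = 0"
    using bounded_clinear_add[OF assms(1), of 0 0] by simp
  have "orthonormal_upto k ?e"
    using e(1) by (auto simp: orthonormal_upto_def cinner_zero_left cinner_zero_right)
  then show ?thesis
    by (rule orthonormal_imp_rank_numerical_range[OF assms(1)])
       (simp add: e(2) cinner_zero_left cinner_zero_right A0)
qed

text \<open>
  The extension step imposes no relation among the vectors of \<open>S\<close>. A unit vector is sought in a
  subspace on which the compression of \<open>A\<close> is \<open>c\<close> and whose dimension exceeds the number of linear
  equations. These equations make the new vector orthogonal to \<open>S\<close> and annihilate its matrix entries
  with \<open>S\<close> on both sides of the diagonal. The condition \<open>cinner (A v) x = 0\<close>, conjugate linear in
  \<open>x\<close>, is written as the linear equation \<open>cinner x (A v) = 0\<close>.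
\<close>

lemma rank_numerical_ranges_imp_infinity:
  fixes A :: "'a::complex_hilbert_space \<Rightarrow> 'a"
  assumes A: "bounded_clinear A" and all: "\<And>k::nat. k \<ge> 1 \<Longrightarrow> c \<in> rank_numerical_range (enat k) A"
  shows "c \<in> rank_numerical_range \<infinity> A"
proof -
  define Q where "Q S x \<longleftrightarrow> norm x = 1 \<and> cinner (A x) x = c \<and>
     (\<forall>v\<in>S. cinner x v = 0 \<and> cinner x (A v) = 0 \<and> cinner (A x) v = 0)" for S x
  have step: "\<exists>x. Q S x" if "finite S" for S :: "'a set"
  proof -
    obtain P where P: "orthogonal_projection P" "ecdim (range P) = enat (Suc (3 * card S))"
        "\<forall>x. P (A (P x)) = c *\<^sub>C P x"
      using all[of "Suc (3 * card S)"] by (auto simp: rank_numerical_range_def)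
    obtain B where B: "B \<subseteq> range P" "complex_vector.independent B" "finite B" "card B = Suc (3 * card S)"
      using finite_ecdim_imp_independent_subset[OF P(2)] by blast
    let ?F1 = "(\<lambda>v x. cinner x v) ` S"
    let ?F2 = "(\<lambda>v x. cinner x (A v)) ` S"
    let ?F3 = "(\<lambda>v x. cinner (A x) v) ` S"
    have "card (?F1 \<union> ?F2 \<union> ?F3) \<le> card ?F1 + card ?F2 + card ?F3"
      by (meson card_Un_le add_le_mono1 order_trans)
    also have "\<dots> \<le> card S + card S + card S"
      by (intro add_mono card_image_le that)
    finally have "card (?F1 \<union> ?F2 \<union> ?F3) < card B" using B(4) by simp
    then have "\<exists>x\<in>cspan B. norm x = 1 \<and> (\<forall>f\<in>?F1 \<union> ?F2 \<union> ?F3. f x = 0)"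
      using that by (intro unit_vector_in_common_kernel[OF B(2,3)])
        (auto intro: linear_cinner_left linear_cinner_bounded_clinear[OF A])
    then obtain x where x: "x \<in> cspan B" "norm x = 1" "\<forall>f\<in>?F1 \<union> ?F2 \<union> ?F3. f x = 0"
      by blast
    have "x \<in> range P"
      using x(1) complex_vector.span_minimal[OF B(1) subspace_range_orthogonal_projection[OF P(1)]] by blast
    then have "cinner (A x) x = c * cinner x x"
      by (intro rank_numerical_range_cinner[of P A c x x] P(1,3))
    then have "cinner (A x) x = c"
      by (simp add: cinner_self x(2))
    then have "Q S x"
      using x(2,3) by (simp add: Q_def ball_Un)
    then show ?thesis ..
  qed
  obtain e :: "nat \<Rightarrow> 'a" where e: "\<forall>n. Q (e ` {..<n}) (e n)"
    using greedy_sequence[of Q] step by blast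
  then have on: "orthonormal_upto \<infinity> e"
    by (intro orthonormal_upto_infinityI) (auto simp: Q_def)
  have "cinner (A (e i)) (e j) = c * cinner (e i) (e j)" for i j
  proof (cases i j rule: linorder_cases)
    case less
    then have "cinner (e j) (A (e i)) = 0" using e by (auto simp: Q_def)
    then have "cinner (A (e i)) (e j) = 0" using cinner_commute[of "A (e i)"] by simp
    then show ?thesis using less by (simp add: cinner_orthonormal[OF on])
  next
    case equal
    then show ?thesis using e by (simp add: cinner_orthonormal[OF on] Q_def)
  next
    case greater
    then have "cinner (A (e i)) (e j) = 0" using e by (auto simp: Q_def)
    then show ?thesis using greater by (simp add: cinner_orthonormal[OF on])
  qed
  then show ?thesis by (rule orthonormal_imp_rank_numerical_range[OF A on])
qed

text \<open>
  Along a subsequence \<open>r\<close>, compactness gives a limit \<open>y\<close> of \<open>(A - \<mu>) (e (r n))\<close>. Replacing these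
  vectors by \<open>y\<close> changes the diagonal entries by a null sequence, and \<open>cinner y (e (r n))\<close> tends to
  \<open>0\<close> by the Bessel inequality.
\<close>

lemma rank_numerical_range_infinity_compact_perturbation:
  fixes A :: "'a::complex_inner \<Rightarrow> 'a"
  assumes K: "compact_operator (\<lambda>x. A x - \<mu> *\<^sub>C x)" and c: "c \<in> rank_numerical_range \<infinity> A"
  shows "c = \<mu>"
proof -
  obtain e where e: "orthonormal_upto \<infinity> e" "\<And>i j. cinner (A (e i)) (e j) = c * cinner (e i) (e j)"
    using rank_numerical_range_infinity_imp_orthonormal[OF c] by blast
  let ?K = "\<lambda>x. A x - \<mu> *\<^sub>C x"
  have norm_e: "norm (e n) = 1" for n by (rule norm_orthonormal[OF e(1)]) simp
  have Ke: "cinner (?K (e n)) (e n) = c - \<mu>" for n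
    by (simp add: cinner_diff_left cinner_scaleC_left e(2) cinner_orthonormal[OF e(1)])
  have "seq_compact (closure (?K ` cball 0 1))"
    using K by (simp add: compact_operator_def compact_eq_seq_compact_metric)
  moreover have "\<forall>n. ?K (e n) \<in> closure (?K ` cball 0 1)"
    by (rule allI, rule subsetD[OF closure_subset], rule imageI) (simp add: norm_e)
  ultimately obtain y r where r: "strict_mono (r :: nat \<Rightarrow> nat)" "((\<lambda>n. ?K (e n)) \<circ> r) \<longlonglongrightarrow> y"
    by (rule seq_compactE)
  have "(\<lambda>n. cinner (?K (e (r n)) - y) (e (r n))) \<longlonglongrightarrow> 0" (is "?f \<longlonglongrightarrow> 0")
  proof (rule Lim_null_comparison)
    show "\<forall>\<^sub>F n in sequentially. norm (cinner (?K (e (r n)) - y) (e (r n))) \<le> norm (?K (e (r n)) - y)"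
    proof (rule always_eventually, rule allI)
      fix n
      show "norm (cinner (?K (e (r n)) - y) (e (r n))) \<le> norm (?K (e (r n)) - y)"
        using norm_cinner_le[of "?K (e (r n)) - y" "e (r n)"] by (simp add: norm_e)
    qed
    show "(\<lambda>n. norm (?K (e (r n)) - y)) \<longlonglongrightarrow> 0"
      using r(2) by (simp add: o_def tendsto_norm_zero_iff LIM_zero_iff)
  qed
  moreover have "(\<lambda>n. cinner y (e (r n))) \<longlonglongrightarrow> 0" (is "?g \<longlonglongrightarrow> 0")
    using LIMSEQ_subseq_LIMSEQ[OF Fourier_coefficients_tendsto_zero[OF e(1), of y] r(1)]
    by (simp add: o_def)
  ultimately have "(\<lambda>n. ?f n + ?g n) \<longlonglongrightarrow> 0 + 0"
    by (rule tendsto_add)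
  moreover have "?f n + ?g n = c - \<mu>" for n
    using Ke[of "r n"] by (simp add: cinner_diff_left)
  ultimately have "(\<lambda>n::nat. c - \<mu>) \<longlonglongrightarrow> 0"
    by simp
  then show ?thesis by (simp add: LIMSEQ_const_iff)
qed

theorem proposition5p4:
  fixes A :: "'a::complex_hilbert_space \<Rightarrow> 'a" and \<mu> :: complex
  assumes "ecdim (UNIV :: 'a set) = \<infinity>"
    and "bounded_clinear A"
    and "compact_operator (\<lambda>x. A x - \<mu> *\<^sub>C x)"
  shows "(rank_numerical_range \<infinity> A \<noteq> {} \<longleftrightarrow> rank_numerical_range \<infinity> A = {\<mu>}) \<and>
         (rank_numerical_range \<infinity> A = {\<mu>} \<longleftrightarrow>
            (\<forall>k::nat. k \<ge> 1 \<longrightarrow> \<mu> \<in> rank_numerical_range (enat k) A))"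
proof -
  have "rank_numerical_range \<infinity> A \<subseteq> {\<mu>}"
  proof
    fix c assume "c \<in> rank_numerical_range \<infinity> A"
    then have "c = \<mu>"
      by (rule rank_numerical_range_infinity_compact_perturbation[OF assms(3)])
    then show "c \<in> {\<mu>}" by simp
  qed
  then have "rank_numerical_range \<infinity> A \<noteq> {} \<longleftrightarrow> \<mu> \<in> rank_numerical_range \<infinity> A"
    and "rank_numerical_range \<infinity> A = {\<mu>} \<longleftrightarrow> \<mu> \<in> rank_numerical_range \<infinity> A"
    by auto
  moreover have "\<mu> \<in> rank_numerical_range \<infinity> A \<longleftrightarrow>
      (\<forall>k::nat. k \<ge> 1 \<longrightarrow> \<mu> \<in> rank_numerical_range (enat k) A)"
  proof (intro iffI allI impI)
    fix k :: nat
    assume "\<mu> \<in> rank_numerical_range \<infinity> A"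
    then show "\<mu> \<in> rank_numerical_range (enat k) A"
      by (rule rank_numerical_range_infinity_subset[OF assms(2)])
  next
    assume "\<forall>k::nat. k \<ge> 1 \<longrightarrow> \<mu> \<in> rank_numerical_range (enat k) A"
    then show "\<mu> \<in> rank_numerical_range \<infinity> A"
      by (intro rank_numerical_ranges_imp_infinity[OF assms(2)]) simp
  qed
  ultimately show ?thesis by simp
qed

end
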